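(* Let $G=U\times V$ be a finite CI-group with $\gcd(|U|,|V|)=1$, where $U$ is abelian with all Sylow subgroups elementary abelian, and $V$ is isomorphic to one of $Q_8$, $\mathbb{Z}_2^2\rtimes\mathbb{Z}_3$, $\mathbb{Z}_2^2\rtimes\mathbb{Z}_9$, $Q_8\rtimes\mathbb{Z}_3$, $Q_8\rtimes\mathbb{Z}_9$, $\mathbb{Z}_3^2\rtimes Q_8$. Then $G$ does not have the $k$-if property for any integer $k\geq2$.
   Context: $Q_8$ is the quaternion group of order 8; the semidirect products are the nonabelian ones (the cyclic factor acting via an automorphism of order 3, and $Q_8$ acting faithfully on $\mathbb{Z}_3^2$). For a finite group $G$ let $G^*=G\setminus\{1\}$. For an inverse-closed $S\subseteq G^*$, $\mathrm{Cay}(G,S)$ has vertex set $G$ and edges $\{h,g\}$ with $gh^{-1}\in S$. $G$ is a CI-group if for all inverse-closed $S,T\subseteq G^*$, $\mathrm{Cay}(G,S)\cong\mathrm{Cay}(G,T)$ implies $T=S^{\alpha}$ for some $\alpha\in\mathrm{Aut}(G)$. A partition of a set is a collection of non-empty pairwise disjoint subsets whose union is the set. $\mathrm{Cay}(G,S)$ is a $k$-if Cayley graph if there is a partition $\{S_0=S,\dots,S_{k-1}\}$ of $G^*$ into inverse-closed subsets with $\mathrm{Cay}(G,S_i)\cong\mathrm{Cay}(G,S)$ for all $i$; $G$ has the $k$-if property if some $\mathrm{Cay}(G,S)$ is a $k$-if Cayley graph. *)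

theory Defs
  imports
    "HOL-Computational_Algebra.Primes"
    "HOL-Library.Disjoint_Sets"
    "HOL-Algebra.Elementary_Groups"
    "HOL-Algebra.Multiplicative_Group"
    "HOL-Algebra.Bij"
begin

text \<open>A simple undirected graph is a pair of a vertex set and a set of unordered edges.\<close>

type_synonym 'a ugraph = "'a set \<times> 'a set set"

definition ugraph_iso :: "'a ugraph \<Rightarrow> 'b ugraph \<Rightarrow> bool" where
  "ugraph_iso X Y \<longleftrightarrow>
     (\<exists>f. bij_betw f (fst X) (fst Y) \<and>
          (\<forall>u\<in>fst X. \<forall>v\<in>fst X. {u, v} \<in> snd X \<longleftrightarrow> {f u, f v} \<in> snd Y))"

definition nonidentity :: "('a, 'm) monoid_scheme \<Rightarrow> 'a set" where
  "nonidentity G = carrier G - {\<one>\<^bsub>G\<^esub>}"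

definition inverse_closed :: "('a, 'm) monoid_scheme \<Rightarrow> 'a set \<Rightarrow> bool" where
  "inverse_closed G S \<longleftrightarrow> (\<forall>s\<in>S. inv\<^bsub>G\<^esub> s \<in> S)"

definition Cay :: "('a, 'm) monoid_scheme \<Rightarrow> 'a set \<Rightarrow> 'a ugraph" where
  "Cay G S =
     (carrier G,
      {{h, g} | h g. h \<in> carrier G \<and> g \<in> carrier G \<and> g \<otimes>\<^bsub>G\<^esub> inv\<^bsub>G\<^esub> h \<in> S})"

definition CI_group :: "('a, 'm) monoid_scheme \<Rightarrow> bool" where
  "CI_group G \<longleftrightarrow>
     group G \<and> finite (carrier G) \<and>
     (\<forall>S T. S \<subseteq> nonidentity G \<and> inverse_closed G S \<and>
            T \<subseteq> nonidentity G \<and> inverse_closed G T \<and>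
            ugraph_iso (Cay G S) (Cay G T)
            \<longrightarrow> (\<exists>\<alpha>\<in>auto G. T = \<alpha> ` S))"

definition k_if_Cayley_graph :: "('a, 'm) monoid_scheme \<Rightarrow> nat \<Rightarrow> 'a set \<Rightarrow> bool" where
  "k_if_Cayley_graph G k S \<longleftrightarrow>
     (\<exists>P. partition_on (nonidentity G) P \<and> card P = k \<and> S \<in> P \<and>
          (\<forall>T\<in>P. inverse_closed G T \<and> ugraph_iso (Cay G T) (Cay G S)))"

definition k_if_property :: "('a, 'm) monoid_scheme \<Rightarrow> nat \<Rightarrow> bool" where
  "k_if_property G k \<longleftrightarrow> (\<exists>S. k_if_Cayley_graph G k S)"

definition Sylow_subgroup :: "nat \<Rightarrow> 'a set \<Rightarrow> ('a, 'm) monoid_scheme \<Rightarrow> bool" where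
  "Sylow_subgroup p P G \<longleftrightarrow> subgroup P G \<and> card P = p ^ multiplicity p (order G)"

definition elementary_abelian :: "nat \<Rightarrow> ('a, 'm) monoid_scheme \<Rightarrow> bool" where
  "elementary_abelian p H \<longleftrightarrow>
     comm_group H \<and> (\<forall>x\<in>carrier H. x [^]\<^bsub>H\<^esub> p = \<one>\<^bsub>H\<^esub>)"

text \<open>A quadruple stands for the quaternion \<open>a + b i + c j + d k\<close>; multiplication in
  \<open>Q8\<close> is the Hamilton product, restricted to \<open>{1, -1, i, -i, j, -j, k, -k}\<close>.\<close>

fun hamilton_mult :: "int \<times> int \<times> int \<times> int \<Rightarrow> int \<times> int \<times> int \<times> int \<Rightarrow> int \<times> int \<times> int \<times> int" where
  "hamilton_mult (a, b, c, d) (a', b', c', d') =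
     (a * a' - b * b' - c * c' - d * d',
      a * b' + b * a' + c * d' - d * c',
      a * c' - b * d' + c * a' + d * b',
      a * d' + b * c' - c * b' + d * a')"

definition Q8 :: "(int \<times> int \<times> int \<times> int) monoid" where
  "Q8 = \<lparr>carrier = {(1, 0, 0, 0), (-1, 0, 0, 0), (0, 1, 0, 0), (0, -1, 0, 0),
                    (0, 0, 1, 0), (0, 0, -1, 0), (0, 0, 0, 1), (0, 0, 0, -1)},
         monoid.mult = hamilton_mult,
         one = (1, 0, 0, 0)\<rparr>"

lemma group_Q8: "group Q8"
proof (rule groupI)
  fix x y z assume "x \<in> carrier Q8" "y \<in> carrier Q8" "z \<in> carrier Q8"
  show "x \<otimes>\<^bsub>Q8\<^esub> y \<otimes>\<^bsub>Q8\<^esub> z = x \<otimes>\<^bsub>Q8\<^esub> (y \<otimes>\<^bsub>Q8\<^esub> z)"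
    by (cases x; cases y; cases z) (simp add: Q8_def algebra_simps)
qed (auto simp: Q8_def)

definition semidirect_product ::
  "('n, 'm1) monoid_scheme \<Rightarrow> ('h, 'm2) monoid_scheme \<Rightarrow> ('h \<Rightarrow> 'n \<Rightarrow> 'n) \<Rightarrow> ('n \<times> 'h) monoid" where
  "semidirect_product N H \<phi> =
     \<lparr>carrier = carrier N \<times> carrier H,
      monoid.mult = (\<lambda>(n, h) (n', h'). (n \<otimes>\<^bsub>N\<^esub> \<phi> h n', h \<otimes>\<^bsub>H\<^esub> h')),
      one = (\<one>\<^bsub>N\<^esub>, \<one>\<^bsub>H\<^esub>)\<rparr>"

lemma group_semidirect_product:
  assumes N: "group N" and H: "group H" and \<phi>: "\<phi> \<in> hom H (AutoGroup N)"
  shows "group (semidirect_product N H \<phi>)"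
proof -
  interpret N: group N by fact
  interpret H: group H by fact
  interpret A: group "AutoGroup N" by (rule N.AutoGroup)
  interpret \<phi>: group_hom H "AutoGroup N" \<phi>
    by unfold_locales (rule \<phi>)
  have auto: "\<phi> h \<in> auto N" if "h \<in> carrier H" for h
    using \<phi>.hom_closed[OF that] by (simp add: AutoGroup_def)
  have closed: "\<phi> h n \<in> carrier N" if "h \<in> carrier H" "n \<in> carrier N" for h n
    using auto[OF that(1)] that(2) by (auto simp: auto_def hom_def)
  have mult: "\<phi> h (n \<otimes>\<^bsub>N\<^esub> n') = \<phi> h n \<otimes>\<^bsub>N\<^esub> \<phi> h n'"
    if "h \<in> carrier H" "n \<in> carrier N" "n' \<in> carrier N" for h n n'
    using auto[OF that(1)] that(2,3) by (auto simp: auto_def hom_def)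
  have one: "\<phi> \<one>\<^bsub>H\<^esub> n = n" if "n \<in> carrier N" for n
    using \<phi>.hom_one that by (simp add: AutoGroup_def BijGroup_def)
  have comp: "\<phi> (h \<otimes>\<^bsub>H\<^esub> h') n = \<phi> h (\<phi> h' n)"
    if "h \<in> carrier H" "h' \<in> carrier H" "n \<in> carrier N" for h h' n
    using \<phi>.hom_mult[OF that(1,2)] auto[OF that(1)] auto[OF that(2)] that(3)
    by (simp add: AutoGroup_def BijGroup_def auto_def compose_def)
  show ?thesis
  proof (rule groupI)
    fix x assume "x \<in> carrier (semidirect_product N H \<phi>)"
    then obtain n h where x: "x = (n, h)" "n \<in> carrier N" "h \<in> carrier H"
      by (auto simp: semidirect_product_def)
    have "(\<phi> (inv\<^bsub>H\<^esub> h) (inv\<^bsub>N\<^esub> n), inv\<^bsub>H\<^esub> h) \<otimes>\<^bsub>semidirect_product N H \<phi>\<^esub> x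
        = (\<phi> (inv\<^bsub>H\<^esub> h) (inv\<^bsub>N\<^esub> n \<otimes>\<^bsub>N\<^esub> n), \<one>\<^bsub>H\<^esub>)"
      using x by (simp add: semidirect_product_def mult[symmetric] del: N.l_inv \<phi>.hom_inv)
    also have "\<phi> (inv\<^bsub>H\<^esub> h) (inv\<^bsub>N\<^esub> n \<otimes>\<^bsub>N\<^esub> n) = \<one>\<^bsub>N\<^esub>"
      using x mult[of "inv\<^bsub>H\<^esub> h" "\<one>\<^bsub>N\<^esub>" "\<one>\<^bsub>N\<^esub>"] closed[of "inv\<^bsub>H\<^esub> h" "\<one>\<^bsub>N\<^esub>"]
      by (simp del: \<phi>.hom_inv)
    finally show "\<exists>y\<in>carrier (semidirect_product N H \<phi>).
        y \<otimes>\<^bsub>semidirect_product N H \<phi>\<^esub> x = \<one>\<^bsub>semidirect_product N H \<phi>\<^esub>"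
      using x
      by (intro bexI[of _ "(\<phi> (inv\<^bsub>H\<^esub> h) (inv\<^bsub>N\<^esub> n), inv\<^bsub>H\<^esub> h)"])
        (auto simp: semidirect_product_def closed simp del: \<phi>.hom_inv)
  qed (auto simp: semidirect_product_def closed mult one comp N.m_assoc H.m_assoc
      simp del: \<phi>.hom_mult \<phi>.hom_one)
qed

text \<open>The generator \<open>1\<close> of \<open>integer_mod_group m\<close> acts on \<open>N\<close> via an automorphism of order 3.\<close>

definition is_cyclic_semidirect ::
  "('v, 'm1) monoid_scheme \<Rightarrow> ('n, 'm2) monoid_scheme \<Rightarrow> nat \<Rightarrow> bool" where
  "is_cyclic_semidirect V N m \<longleftrightarrow>
     (\<exists>\<phi>\<in>hom (integer_mod_group m) (AutoGroup N).
        group.ord (AutoGroup N) (\<phi> 1) = 3 \<and>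
        V \<cong> semidirect_product N (integer_mod_group m) \<phi>)"

definition is_faithful_semidirect ::
  "('v, 'm1) monoid_scheme \<Rightarrow> ('n, 'm2) monoid_scheme \<Rightarrow> ('h, 'm3) monoid_scheme \<Rightarrow> bool" where
  "is_faithful_semidirect V N H \<longleftrightarrow>
     (\<exists>\<phi>\<in>hom H (AutoGroup N).
        inj_on \<phi> (carrier H) \<and> V \<cong> semidirect_product N H \<phi>)"

end

theory Submission
  imports Defs
begin

text \<open>In a CI-group the cells of an isomorphic partition of \<open>G\<^sup>*\<close> are images of one another under
  automorphisms, so they contain equally many elements \<open>x\<close> with \<open>x\<^sup>p = 1\<close>. Writing \<open>N\<^sub>p\<close> for the
  number of solutions of \<open>x\<^sup>p = 1\<close>, this gives \<open>k dvd N\<^sub>p - 1\<close>. If \<open>p\<close> is a prime divisor of \<open>|V|\<close>,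
  then all solutions lie in \<open>V\<close>, and \<open>p dvd N\<^sub>p\<close> by Frobenius, so that \<open>k\<close> is prime to \<open>p\<close>.
  For \<open>V\<close> of the form \<open>Q8\<close> or \<open>Q8 : Z\<^sub>m\<close> we have \<open>N\<^sub>2 = 2\<close>; for \<open>Z\<^sub>2\<^sup>2 : Z\<^sub>m\<close> we have \<open>N\<^sub>2 = 4\<close>,
  while \<open>k\<close> is prime to 3; for \<open>Z\<^sub>3\<^sup>2 : Q8\<close> we have \<open>N\<^sub>3 = 9\<close>, while \<open>k\<close> is odd. In each case \<open>k = 1\<close>.\<close>

section \<open>Counting fixed points modulo a prime\<close>

text \<open>Every orbit of \<open>f\<close> has exactly \<open>p\<close> elements; the induction
  strips off one orbit at a time.\<close>

lemma prime_dvd_card_if_fixpoint_free: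
  assumes "prime p" and "finite B"
    and "\<And>x. x \<in> B \<Longrightarrow> f x \<in> B" and "\<And>x. x \<in> B \<Longrightarrow> (f ^^ p) x = x"
    and "\<And>x. x \<in> B \<Longrightarrow> f x \<noteq> x"
  shows "p dvd card B"
  using assms(2-)
proof (induction B rule: finite_psubset_induct)
  case (psubset B)
  have p0: "p > 0" using \<open>prime p\<close> by (simp add: prime_gt_0_nat)
  have iter_in: "(f ^^ i) x \<in> B" if "x \<in> B" for i x
    using that by (induction i) (auto simp: psubset.prems(1))
  have iter_mod: "(f ^^ (i mod p)) x = (f ^^ i) x" if "x \<in> B" for i x
    using funpow_mod_eq[OF psubset.prems(2)[OF that]] by simp
  show ?case
  proof (cases "B = {}")
    case False
    then obtain x where x: "x \<in> B" by blast
    define Orb where "Orb = (\<lambda>i. (f ^^ i) x) ` {..<p}"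
    have "Orb \<subseteq> B" using iter_in[OF x] by (auto simp: Orb_def)
    have in_Orb: "(f ^^ i) x \<in> Orb" for i
      unfolding Orb_def using iter_mod[OF x, of i] p0
      by (intro image_eqI[of _ _ "i mod p"]) auto
    have no_coll: "(f ^^ i) x \<noteq> (f ^^ j) x" if "i < j" "j < p" for i j
    proof
      assume "(f ^^ i) x = (f ^^ j) x"
      \<comment> \<open>Applying \<open>f ^^ (p - i)\<close> to a collision gives
        \<open>(f ^^ (j - i)) x = x\<close>, because \<open>f ^^ p\<close> fixes
        \<open>x\<close>.\<close>
      then have "(f ^^ (p - i + i)) x = (f ^^ (p - i + j)) x"
        by (simp only: funpow_add o_apply)
      moreover have "p - i + j = p + (j - i)" "p - i + i = p" using that by auto
      moreover have "(f ^^ (p + (j - i))) x = (f ^^ (j - i)) x"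
        using iter_mod[OF x, of "p + (j - i)"] iter_mod[OF x, of "j - i"] by simp
      ultimately have fix_d: "(f ^^ (j - i)) x = x" using psubset.prems(2)[OF x] by metis
      \<comment> \<open>As \<open>0 < j - i < p\<close>, Bezout makes 1 a multiple of
        \<open>j - i\<close> modulo \<open>p\<close>, so iterating \<open>f ^^ (j - i)\<close> shows
        that \<open>f\<close> itself fixes \<open>x\<close>.\<close>
      have "coprime (j - i) p"
        using \<open>prime p\<close> that by (metis coprime_commute dvd_imp_le le_less_trans diff_le_self
            not_less prime_imp_coprime zero_less_diff)
      then have "gcd (j - i) p = 1" by simp
      moreover have "j - i \<noteq> 0" using that by linarith
      ultimately obtain u v where "(j - i) * u = p * v + 1"
        using bezout_nat[of "j - i" p] by metis
      then have "(j - i) * u mod p = 1" using prime_gt_1_nat[OF \<open>prime p\<close>] by (simp only: mod_mult_self4 mod_less)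
      moreover have "(f ^^ ((j - i) * u)) x = x"
        using fix_d by (induction u) (simp_all add: funpow_add)
      ultimately have "f x = x" using iter_mod[OF x, of "(j - i) * u"] by simp
      with psubset.prems(3)[OF x] show False by blast
    qed
    have "inj_on (\<lambda>i. (f ^^ i) x) {..<p}"
      by (rule inj_onI) (metis lessThan_iff linorder_neqE_nat no_coll)
    then have "card Orb = p" by (simp add: Orb_def card_image)
    have closed: "f y \<in> B - Orb" if "y \<in> B - Orb" for y
    proof -
      \<comment> \<open>The orbit cannot be entered from outside: \<open>y\<close> equals
        \<open>(f ^^ (p - 1)) (f y)\<close>, which lies in \<open>Orb\<close> once
        \<open>f y\<close> does.\<close>
      have "f y \<notin> Orb"
      proof
        assume "f y \<in> Orb"
        then obtain i where "f y = (f ^^ i) x" by (auto simp: Orb_def)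
        then have "(f ^^ (p - 1)) (f y) = (f ^^ (p - 1 + i)) x" by (simp add: funpow_add)
        moreover have "(f ^^ (p - 1)) (f y) = (f ^^ p) y"
          using p0 by (metis Suc_diff_1 comp_apply funpow_Suc_right)
        ultimately show False using in_Orb that psubset.prems(2) by (metis DiffD1 DiffD2)
      qed
      with that psubset.prems(1) show ?thesis by blast
    qed
    have "B - Orb \<subset> B" using in_Orb[of 0] x \<open>Orb \<subseteq> B\<close> by auto
    then have "p dvd card (B - Orb)"
      by (rule psubset.IH) (use closed psubset.prems in auto)
    moreover have "card B = card (B - Orb) + card Orb"
      using \<open>Orb \<subseteq> B\<close> psubset.hyps
      by (metis card_Diff_subset card_mono finite_subset le_add_diff_inverse2)
    ultimately show ?thesis using \<open>card Orb = p\<close> by simp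
  qed simp
qed

lemma prime_dvd_card_iff_dvd_card_fixpoints:
  assumes "prime p" and "finite A"
    and "\<And>x. x \<in> A \<Longrightarrow> f x \<in> A" and "\<And>x. x \<in> A \<Longrightarrow> (f ^^ p) x = x"
  shows "p dvd card A \<longleftrightarrow> p dvd card {x \<in> A. f x = x}"
proof -
  \<comment> \<open>If \<open>f x\<close> is fixed, then
    \<open>x = (f ^^ (p - 1)) (f x) = f x\<close>. So the non-fixed points are stable under
    \<open>f\<close> and the preceding lemma applies to them.\<close>
  have "f (f x) \<noteq> f x" if "x \<in> A" "f x \<noteq> x" for x
  proof
    assume "f (f x) = f x"
    then have "(f ^^ n) (f x) = f x" for n by (induction n) auto
    moreover have "(f ^^ (p - 1)) (f x) = (f ^^ p) x"
      using prime_gt_0_nat[OF \<open>prime p\<close>] by (metis Suc_diff_1 comp_apply funpow_Suc_right)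
    ultimately show False using assms(4) that by metis
  qed
  then have "p dvd card {x \<in> A. f x \<noteq> x}"
    using assms by (intro prime_dvd_card_if_fixpoint_free[where f = f]) auto
  moreover have "card A = card {x \<in> A. f x = x} + card {x \<in> A. f x \<noteq> x}"
    using \<open>finite A\<close> by (subst card_Un_disjoint[symmetric]) (auto intro: arg_cong[of _ _ card])
  ultimately show ?thesis by (simp add: dvd_add_left_iff)
qed

section \<open>Solutions of \<open>x^p = 1\<close> in a group\<close>

definition roots_of_one :: "nat \<Rightarrow> ('a, 'm) monoid_scheme \<Rightarrow> 'a set" where
  "roots_of_one p G = {x \<in> carrier G. x [^]\<^bsub>G\<^esub> p = \<one>\<^bsub>G\<^esub>}"

context group
begin

lemma foldr_mult_closed: "set xs \<subseteq> carrier G \<Longrightarrow> foldr (\<otimes>) xs \<one> \<in> carrier G"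
  by (induction xs) auto

text \<open>Meant for rotations: \<open>rotate1 (x # ys)\<close> is \<open>ys @ [x]\<close>, whose
  product this evaluates.\<close>

lemma foldr_mult_snoc:
  "set xs \<subseteq> carrier G \<Longrightarrow> x \<in> carrier G \<Longrightarrow> foldr (\<otimes>) (xs @ [x]) \<one> = foldr (\<otimes>) xs \<one> \<otimes> x"
  by (induction xs) (auto simp: m_assoc foldr_mult_closed simp del: foldr_append)

lemma foldr_mult_replicate: "x \<in> carrier G \<Longrightarrow> foldr (\<otimes>) (replicate n x) \<one> = x [^] n"
  by (induction n) (simp_all add: nat_pow_Suc2[symmetric] del: nat_pow_Suc foldr_replicate)

text \<open>McKay's argument: rotation permutes the \<open>|G|\<^sup>p\<^sup>-\<^sup>1\<close> tuples \<open>(x\<^sub>1, \<dots>, x\<^sub>p)\<close> with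
  \<open>x\<^sub>1 \<cdots> x\<^sub>p = 1\<close>, and its fixed points are the constant tuples \<open>(x, \<dots>, x)\<close> with \<open>x\<^sup>p = 1\<close>.\<close>

lemma prime_dvd_card_roots_of_one:
  assumes "finite (carrier G)" and "prime p" and "p dvd order G"
  shows "p dvd card (roots_of_one p G)"
proof -
  define A where
    "A = {xs. set xs \<subseteq> carrier G \<and> length xs = p \<and> foldr (\<otimes>) xs \<one> = \<one>}"
  define B where "B = {ys. set ys \<subseteq> carrier G \<and> length ys = p - 1}"
  have p1: "p > 1" using \<open>prime p\<close> by (rule prime_gt_1_nat)
  \<comment> \<open>The last \<open>p - 1\<close> entries are free; the first is then forced to be
    the inverse of their product.\<close>
  have "bij_betw (\<lambda>ys. inv (foldr (\<otimes>) ys \<one>) # ys) B A"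
  proof (rule bij_betw_byWitness[where f' = tl])
    show "\<forall>xs\<in>A. inv (foldr (\<otimes>) (tl xs) \<one>) # tl xs = xs"
    proof
      fix xs assume xs: "xs \<in> A"
      then obtain x ys where "xs = x # ys" using p1 by (cases xs) (auto simp: A_def)
      with xs show "inv (foldr (\<otimes>) (tl xs) \<one>) # tl xs = xs"
        by (auto simp: A_def foldr_mult_closed intro: inv_equality)
    qed
    show "tl ` A \<subseteq> B" by (auto simp: A_def B_def) (metis in_mono list.sel(2) list.set_sel(2))
  qed (use p1 in \<open>auto simp: A_def B_def foldr_mult_closed\<close>)
  then have "card A = card B" by (rule bij_betw_same_card[symmetric])
  also have "\<dots> = order G ^ (p - 1)"
    using card_lists_length_eq[OF assms(1)] by (simp add: B_def order_def)
  \<comment> \<open>The exponent \<open>p - 1\<close> is positive, so the power inherits the divisor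
    \<open>p\<close> of \<open>order G\<close>.\<close>
  finally have "p dvd card A" using assms(3) p1 by (auto intro: dvd_trans dvd_power)
  moreover have "finite A"
    using finite_lists_length_eq[OF assms(1), of p] by (rule rev_finite_subset) (auto simp: A_def)
  \<comment> \<open>If \<open>x\<close> times the product of \<open>ys\<close> is one, then so is
    the product of \<open>ys\<close> times \<open>x\<close>.\<close>
  moreover have "rotate1 xs \<in> A" if "xs \<in> A" for xs
  proof -
    from that obtain x ys where "xs = x # ys" using p1 by (cases xs) (auto simp: A_def)
    with that show ?thesis
      by (auto simp: A_def foldr_mult_snoc foldr_mult_closed inv_comm simp del: foldr_append)
  qed
  moreover have "(rotate1 ^^ p) xs = xs" if "xs \<in> A" for xs
    using that rotate_id[of p xs] by (simp add: A_def rotate_def)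
  ultimately have "p dvd card {xs \<in> A. rotate1 xs = xs}"
    using prime_dvd_card_iff_dvd_card_fixpoints[OF \<open>prime p\<close>, of A rotate1] by blast
  moreover have "bij_betw (replicate p) (roots_of_one p G) {xs \<in> A. rotate1 xs = xs}"
    unfolding bij_betw_def
  proof
    show "inj_on (replicate p) (roots_of_one p G)"
      using p1 by (auto simp: inj_on_def)
    show "replicate p ` roots_of_one p G = {xs \<in> A. rotate1 xs = xs}"
    proof (intro equalityI subsetI)
      fix xs assume "xs \<in> replicate p ` roots_of_one p G"
      then show "xs \<in> {xs \<in> A. rotate1 xs = xs}"
        by (auto simp: A_def roots_of_one_def foldr_mult_replicate simp del: foldr_replicate)
    next
      fix xs assume xs: "xs \<in> {xs \<in> A. rotate1 xs = xs}"
      \<comment> \<open>Since \<open>p > 1\<close> the list is nonempty, and a nonempty list fixed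
        by \<open>rotate1\<close> has a single distinct entry.\<close>
      then have "card (set xs) = 1" using rotate1_fixpoint_card[of xs] p1 by (auto simp: A_def)
      then obtain x where "set xs = {x}" by (auto simp: card_1_singleton_iff)
      then have "xs = replicate p x" "x \<in> carrier G"
        using xs by (auto simp: A_def intro: replicate_eqI)
      with xs show "xs \<in> replicate p ` roots_of_one p G"
        by (auto simp: A_def roots_of_one_def foldr_mult_replicate simp del: foldr_replicate)
    qed
  qed
  ultimately show ?thesis by (simp add: bij_betw_same_card)
qed

lemma pow_coprime_order_eq_one:
  assumes "x \<in> carrier G" and "x [^] p = \<one>" and "coprime p (order G)"
  shows "x = \<one>"
proof -
  have "ord x dvd p" using assms(1,2) by (simp add: pow_eq_id)
  moreover have "ord x dvd order G" using assms(1) by (rule ord_dvd_group_order)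
  ultimately have "ord x = 1" using assms(3) by (metis coprime_common_divisor_nat)
  then show ?thesis using pow_ord_eq_1[OF assms(1)] assms(1) by simp
qed

end

section \<open>The number of solutions under isomorphisms and products\<close>

lemma card_roots_of_one_iso:
  assumes "group G" and "group H" and "G \<cong> H"
  shows "card (roots_of_one p G) = card (roots_of_one p H)"
proof -
  obtain h where h: "h \<in> hom G H" "bij_betw h (carrier G) (carrier H)"
    using assms(3) by (auto simp: is_iso_def iso_def)
  have "h \<one>\<^bsub>G\<^esub> = \<one>\<^bsub>H\<^esub>" using hom_one[OF h(1) assms(1,2)] .
  have "x [^]\<^bsub>G\<^esub> p = \<one>\<^bsub>G\<^esub> \<longleftrightarrow> h x [^]\<^bsub>H\<^esub> p = \<one>\<^bsub>H\<^esub>" if "x \<in> carrier G" for x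
    using hom_nat_pow[OF h(1) that assms(1,2), of p] \<open>h \<one>\<^bsub>G\<^esub> = \<one>\<^bsub>H\<^esub>\<close> that assms(1)
      bij_betw_imp_inj_on[OF h(2)]
    by (metis group.is_monoid inj_on_contraD monoid.nat_pow_closed monoid.one_closed)
  then have "h ` roots_of_one p G = {y \<in> h ` carrier G. y [^]\<^bsub>H\<^esub> p = \<one>\<^bsub>H\<^esub>}"
    by (auto simp: roots_of_one_def)
  then have "h ` roots_of_one p G = roots_of_one p H"
    using bij_betw_imp_surj_on[OF h(2)] by (simp add: roots_of_one_def)
  moreover have "inj_on h (roots_of_one p G)"
    using bij_betw_imp_inj_on[OF h(2)] by (rule inj_on_subset) (auto simp: roots_of_one_def)
  ultimately show ?thesis by (metis card_image)
qed

lemma pow_DirProd: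
  "x [^]\<^bsub>G \<times>\<times> H\<^esub> (n::nat) = (fst x [^]\<^bsub>G\<^esub> n, snd x [^]\<^bsub>H\<^esub> n)"
  by (induction n) (auto simp: DirProd_def nat_pow_def split: prod.splits)

text \<open>The \<open>U\<close>-coordinate of a solution has order dividing both \<open>p\<close>
  and \<open>order U\<close>, hence is trivial.\<close>

lemma card_roots_of_one_DirProd:
  assumes "group U" and "coprime p (order U)"
  shows "card (roots_of_one p (U \<times>\<times> V)) = card (roots_of_one p V)"
proof -
  interpret U: group U by fact
  have "roots_of_one p (U \<times>\<times> V) = {\<one>\<^bsub>U\<^esub>} \<times> roots_of_one p V"
  proof (intro equalityI subsetI)
    fix x assume "x \<in> roots_of_one p (U \<times>\<times> V)"
    then show "x \<in> {\<one>\<^bsub>U\<^esub>} \<times> roots_of_one p V"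
      using U.pow_coprime_order_eq_one[OF _ _ assms(2), of "fst x"]
      by (cases x) (simp add: roots_of_one_def pow_DirProd)
  next
    fix x assume "x \<in> {\<one>\<^bsub>U\<^esub>} \<times> roots_of_one p V"
    then show "x \<in> roots_of_one p (U \<times>\<times> V)"
      by (auto simp: roots_of_one_def pow_DirProd)
  qed
  then show ?thesis by (simp add: card_cartesian_product)
qed

text \<open>Projection to \<open>H\<close> respects powers, so coprimality kills the
  \<open>H\<close>-coordinate of a solution. The identity of \<open>H\<close> acts trivially, so
  powers in the remaining copy of \<open>N\<close> are those of \<open>N\<close>.\<close>

lemma card_roots_of_one_semidirect_product:
  assumes "group N" and "group H" and "\<phi> \<in> hom H (AutoGroup N)" and "coprime p (order H)"
  shows "card (roots_of_one p (semidirect_product N H \<phi>)) = card (roots_of_one p N)"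
proof -
  interpret N: group N by fact
  interpret H: group H by fact
  let ?S = "semidirect_product N H \<phi>"
  interpret A: group "AutoGroup N" by (rule N.AutoGroup)
  have "\<phi> \<one>\<^bsub>H\<^esub> = \<one>\<^bsub>AutoGroup N\<^esub>" by (rule hom_one[OF assms(3) H.is_group A.is_group])
  then have \<phi>_one: "\<phi> \<one>\<^bsub>H\<^esub> n = n" if "n \<in> carrier N" for n
    using that by (simp add: AutoGroup_def BijGroup_def)
  have snd_pow: "snd (x [^]\<^bsub>?S\<^esub> n) = snd x [^]\<^bsub>H\<^esub> n" for x and n :: nat
    by (induction n) (auto simp: semidirect_product_def nat_pow_def split: prod.splits)
  have pow_N: "(n, \<one>\<^bsub>H\<^esub>) [^]\<^bsub>?S\<^esub> k = (n [^]\<^bsub>N\<^esub> k, \<one>\<^bsub>H\<^esub>)" if "n \<in> carrier N" for n and k :: nat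
    using that by (induction k) (simp_all add: semidirect_product_def \<phi>_one)
  have one: "\<one>\<^bsub>?S\<^esub> = (\<one>\<^bsub>N\<^esub>, \<one>\<^bsub>H\<^esub>)" and carrier: "carrier ?S = carrier N \<times> carrier H"
    by (simp_all add: semidirect_product_def)
  have "roots_of_one p ?S = roots_of_one p N \<times> {\<one>\<^bsub>H\<^esub>}"
  proof (intro equalityI subsetI)
    fix x assume x: "x \<in> roots_of_one p ?S"
    obtain n h where [simp]: "x = (n, h)" by (cases x)
    have "h \<in> carrier H" "n \<in> carrier N" "x [^]\<^bsub>?S\<^esub> p = (\<one>\<^bsub>N\<^esub>, \<one>\<^bsub>H\<^esub>)"
      using x by (auto simp: roots_of_one_def one carrier)
    moreover from this snd_pow[of x p] have "h = \<one>\<^bsub>H\<^esub>"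
      using H.pow_coprime_order_eq_one[OF _ _ assms(4), of h] by simp
    ultimately show "x \<in> roots_of_one p N \<times> {\<one>\<^bsub>H\<^esub>}" by (simp add: roots_of_one_def pow_N)
  next
    fix x assume "x \<in> roots_of_one p N \<times> {\<one>\<^bsub>H\<^esub>}"
    then show "x \<in> roots_of_one p ?S" by (auto simp: roots_of_one_def pow_N one carrier)
  qed
  then show ?thesis by (simp add: card_cartesian_product)
qed

text \<open>For the case analysis: the order shows which primes divide \<open>order V\<close>, the
  count then restricts \<open>k\<close>.\<close>

lemma roots_of_one_if_iso_semidirect_product:
  assumes "group V" and "group N" and "group H" and "\<phi> \<in> hom H (AutoGroup N)"
    and "V \<cong> semidirect_product N H \<phi>"
  shows "order V = order N * order H"
    and "coprime p (order H) \<Longrightarrow> card (roots_of_one p V) = card (roots_of_one p N)"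
proof -
  show "order V = order N * order H"
    using iso_same_card[OF assms(5)] by (simp add: order_def semidirect_product_def card_cartesian_product)
  show "card (roots_of_one p V) = card (roots_of_one p N)" if "coprime p (order H)"
    using card_roots_of_one_iso[OF assms(1) group_semidirect_product[OF assms(2-4)] assms(5)]
      card_roots_of_one_semidirect_product[OF assms(2-4) that] by simp
qed

section \<open>Solution counts in the concrete groups\<close>

lemma order_integer_mod_group: "n > 0 \<Longrightarrow> order (integer_mod_group n) = n"
  by (simp add: order_def carrier_integer_mod_group)

text \<open>The \<open>n\<close>-th power of every element is trivial, so the whole group is
  counted.\<close>

lemma card_roots_of_one_integer_mod_group_square:
  assumes "n > 0"
  shows "card (roots_of_one n (integer_mod_group n \<times>\<times> integer_mod_group n)) = n * n"
proof -
  have "roots_of_one n (integer_mod_group n \<times>\<times> integer_mod_group n) =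
      carrier (integer_mod_group n) \<times> carrier (integer_mod_group n)"
    by (auto simp: roots_of_one_def pow_DirProd)
  then show ?thesis
    using order_integer_mod_group[OF assms] by (simp add: card_cartesian_product order_def)
qed

lemma order_Q8: "order Q8 = 8"
  by (simp add: order_def Q8_def)

lemma card_roots_of_one_Q8: "card (roots_of_one 2 Q8) = 2"
proof -
  have "x [^]\<^bsub>Q8\<^esub> (2::nat) = x \<otimes>\<^bsub>Q8\<^esub> x" if "x \<in> carrier Q8" for x
    using that group.is_monoid[OF group_Q8]
    by (simp add: numeral_2_eq_2 monoid.l_one)
  then have "roots_of_one 2 Q8 = {x \<in> carrier Q8. x \<otimes>\<^bsub>Q8\<^esub> x = \<one>\<^bsub>Q8\<^esub>}"
    unfolding roots_of_one_def by auto
  \<comment> \<open>The other six elements square to \<open>(-1, 0, 0, 0)\<close>.\<close>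
  also have "\<dots> = {(1, 0, 0, 0), (-1, 0, 0, 0)}"
    by (auto simp: Q8_def)
  finally show ?thesis by simp
qed

section \<open>Isomorphic partitions of a CI-group\<close>

lemma k_if_dvd_card_roots_of_one:
  assumes "CI_group G" and "k_if_property G k"
  shows "k dvd card (roots_of_one p G) - 1"
proof -
  interpret group G using assms(1) by (simp add: CI_group_def)
  have fin: "finite (carrier G)" using assms(1) by (simp add: CI_group_def)
  obtain S P where P: "partition_on (nonidentity G) P" "card P = k" "S \<in> P"
    and T: "\<And>T. T \<in> P \<Longrightarrow> inverse_closed G T \<and> ugraph_iso (Cay G T) (Cay G S)"
    using assms(2) by (auto simp: k_if_property_def k_if_Cayley_graph_def)
  have sub: "T \<subseteq> nonidentity G" if "T \<in> P" for T
    using P(1) that by (auto simp: partition_on_def)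
  have finP: "finite P" using P(1) fin by (auto simp: nonidentity_def intro: finite_elements)
  have card_T: "card (T \<inter> roots_of_one p G) = card (S \<inter> roots_of_one p G)" if TP: "T \<in> P" for T
  proof -
    \<comment> \<open>The CI property turns the isomorphism of Cayley graphs into an automorphism
      carrying \<open>T\<close> onto \<open>S\<close>; being injective, it both preserves and
      reflects \<open>x^p = 1\<close>.\<close>
    have "\<exists>\<alpha>\<in>auto G. S = \<alpha> ` T"
      using assms(1) T[OF TP] T[OF P(3)] sub[OF TP] sub[OF P(3)] by (simp add: CI_group_def)
    then obtain \<alpha> where \<alpha>: "\<alpha> \<in> hom G G" "inj_on \<alpha> (carrier G)" and S: "S = \<alpha> ` T"
      by (auto simp: auto_def Bij_def bij_betw_def)
    have TG: "T \<subseteq> carrier G" using sub[OF TP] by (auto simp: nonidentity_def)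
    have "\<alpha> x [^]\<^bsub>G\<^esub> p = \<one>\<^bsub>G\<^esub> \<longleftrightarrow> x [^]\<^bsub>G\<^esub> p = \<one>\<^bsub>G\<^esub>" if "x \<in> carrier G" for x
      using hom_nat_pow[OF \<alpha>(1) that is_group is_group, of p] hom_one[OF \<alpha>(1) is_group is_group]
        inj_onD[OF \<alpha>(2), of "x [^]\<^bsub>G\<^esub> p" "\<one>\<^bsub>G\<^esub>"] that by auto
    moreover have "\<alpha> x \<in> carrier G" if "x \<in> carrier G" for x
      using hom_in_carrier[OF \<alpha>(1) that] .
    ultimately have "S \<inter> roots_of_one p G = \<alpha> ` (T \<inter> roots_of_one p G)"
      using TG by (auto simp: S roots_of_one_def)
    moreover have "inj_on \<alpha> (T \<inter> roots_of_one p G)"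
      using \<alpha>(2) TG by (auto intro: inj_on_subset)
    ultimately show ?thesis by (simp add: card_image)
  qed
  \<comment> \<open>The cells cut the nontrivial solutions into \<open>k\<close> disjoint pieces of
    equal size.\<close>
  have "roots_of_one p G - {\<one>\<^bsub>G\<^esub>} = (\<Union>T\<in>P. T \<inter> roots_of_one p G)"
    using P(1) by (auto simp: partition_on_def nonidentity_def roots_of_one_def)
  also have "card \<dots> = (\<Sum>T\<in>P. card (T \<inter> roots_of_one p G))"
  proof (rule card_UN_disjoint)
    show "\<forall>T\<in>P. finite (T \<inter> roots_of_one p G)" using fin by (auto simp: roots_of_one_def)
    show "\<forall>T\<in>P. \<forall>T'\<in>P. T \<noteq> T' \<longrightarrow> T \<inter> roots_of_one p G \<inter> (T' \<inter> roots_of_one p G) = {}"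
      using P(1) by (auto simp: partition_on_def disjoint_def)
  qed (rule finP)
  also have "\<dots> = k * card (S \<inter> roots_of_one p G)" using card_T P(2) by simp
  finally have "k dvd card (roots_of_one p G - {\<one>\<^bsub>G\<^esub>})" by simp
  \<comment> \<open>The identity is itself a solution, so removing it lowers the count by exactly
    one.\<close>
  then show ?thesis by (simp add: roots_of_one_def)
qed

section \<open>Elimination of each possible \<open>V\<close>\<close>

theorem theorem4p5:
  fixes G :: "('g, 'm1) monoid_scheme"
    and U :: "('u, 'm2) monoid_scheme"
    and V :: "('v, 'm3) monoid_scheme"
    and k :: nat
  assumes "group G" and "finite (carrier G)" and "CI_group G"
    and "comm_group U" and "group V"
    and "G \<cong> U \<times>\<times> V"
    and "coprime (order U) (order V)"
    and "\<forall>p P. prime p \<and> Sylow_subgroup p P U \<longrightarrow> elementary_abelian p (U\<lparr>carrier := P\<rparr>)"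
    and "V \<cong> Q8
      \<or> is_cyclic_semidirect V (integer_mod_group 2 \<times>\<times> integer_mod_group 2) 3
      \<or> is_cyclic_semidirect V (integer_mod_group 2 \<times>\<times> integer_mod_group 2) 9
      \<or> is_cyclic_semidirect V Q8 3
      \<or> is_cyclic_semidirect V Q8 9
      \<or> is_faithful_semidirect V (integer_mod_group 3 \<times>\<times> integer_mod_group 3) Q8"
    and "k \<ge> 2"
  shows "\<not> k_if_property G k"
proof
  assume kif: "k_if_property G k"
  interpret U: group U using \<open>comm_group U\<close> by (rule comm_group.axioms)
  interpret V: group V by fact
  have UV: "group (U \<times>\<times> V)" by (rule DirProd_group) (fact U.is_group V.is_group)+
  have "finite (carrier U \<times> carrier V)"
    using \<open>G \<cong> U \<times>\<times> V\<close> \<open>finite (carrier G)\<close>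
    by (auto simp: is_iso_def iso_def DirProd_def dest: bij_betw_finite)
  \<comment> \<open>The carrier of \<open>U\<close> is nonempty, so finiteness of the product passes
    to \<open>V\<close>.\<close>
  then have finV: "finite (carrier V)"
    using U.one_closed by (auto simp: finite_cartesian_product_iff)
  have k_dvd: "k dvd card (roots_of_one p V) - 1" if "prime p" "p dvd order V" for p
  proof -
    have "coprime p (order U)"
      using \<open>coprime (order U) (order V)\<close> that(2)
      by (metis coprime_commute coprime_divisors dvd_refl)
    then have "card (roots_of_one p G) = card (roots_of_one p V)"
      using card_roots_of_one_iso[OF \<open>group G\<close> UV \<open>G \<cong> U \<times>\<times> V\<close>]
        card_roots_of_one_DirProd[OF U.is_group] by simp
    then show ?thesis using k_if_dvd_card_roots_of_one[OF \<open>CI_group G\<close> kif, of p] by simp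
  qed
  have coprime_k: "coprime p k" if "prime p" "p dvd order V" for p
  proof -
    have "\<one>\<^bsub>V\<^esub> \<in> roots_of_one p V" "finite (roots_of_one p V)"
      using finV by (auto simp: roots_of_one_def)
    \<comment> \<open>Positivity makes the natural-number subtraction genuine: as \<open>p\<close>
      divides the count, it cannot divide the predecessor, of which \<open>k\<close> is a
      divisor.\<close>
    then have "card (roots_of_one p V) > 0" by (auto simp: card_gt_0_iff)
    then have "\<not> p dvd card (roots_of_one p V) - 1"
      using V.prime_dvd_card_roots_of_one[OF finV that] prime_gt_1_nat[OF that(1)]
      by (metis Suc_eq_plus1 Suc_pred' dvd_add_right_iff nat_dvd_1_iff_1 less_irrefl)
    then show ?thesis using k_dvd[OF that] prime_imp_coprime[OF that(1)] dvd_trans by blast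
  qed
  note semidirect = roots_of_one_if_iso_semidirect_product[OF V.is_group]
  let ?K = "integer_mod_group 2 \<times>\<times> integer_mod_group 2"
  let ?E = "integer_mod_group 3 \<times>\<times> integer_mod_group 3"
  have orders: "order ?K = 4" "order ?E = 9"
    by (simp_all add: order_def DirProd_def carrier_integer_mod_group card_cartesian_product)
  have groups: "group ?K" "group ?E" by (simp_all add: DirProd_group)
  have Klein: "k dvd 1" if m: "m = 3 \<or> m = 9" and V: "is_cyclic_semidirect V ?K m" for m
  proof -
    obtain \<phi> where \<phi>: "\<phi> \<in> hom (integer_mod_group m) (AutoGroup ?K)"
      "V \<cong> semidirect_product ?K (integer_mod_group m) \<phi>"
      using V by (auto simp: is_cyclic_semidirect_def)
    note sd = semidirect[OF groups(1) group_integer_mod_group \<phi>]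
    have dvd: "2 dvd order V" "3 dvd order V"
      using m sd(1) by (auto simp: orders order_integer_mod_group)
    \<comment> \<open>As \<open>m\<close> is odd, all solutions for \<open>p = 2\<close> come from
      the Klein group, giving \<open>4 - 1 = 3\<close>; the prime 3 enters \<open>order V\<close>
      through \<open>m\<close>.\<close>
    have "coprime 2 (order (integer_mod_group m))" using m by (auto simp: order_integer_mod_group)
    then have "k dvd 3"
      using k_dvd[of 2] sd(2) dvd card_roots_of_one_integer_mod_group_square[of 2] by simp
    moreover have "coprime 3 k" using coprime_k[of 3] dvd by simp
    ultimately show ?thesis using coprime_common_divisor[of 3 k k] by simp
  qed
  have quaternion: "k dvd 1" if m: "m = 3 \<or> m = 9" and V: "is_cyclic_semidirect V Q8 m" for m
  proof -
    obtain \<phi> where \<phi>: "\<phi> \<in> hom (integer_mod_group m) (AutoGroup Q8)"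
      "V \<cong> semidirect_product Q8 (integer_mod_group m) \<phi>"
      using V by (auto simp: is_cyclic_semidirect_def)
    note sd = semidirect[OF group_Q8 group_integer_mod_group \<phi>]
    have "coprime 2 (order (integer_mod_group m))" using m by (auto simp: order_integer_mod_group)
    \<comment> \<open>Again \<open>m\<close> is odd, so the count is that of \<open>Q8\<close> and
      \<open>k\<close> divides \<open>2 - 1\<close>.\<close>
    then show ?thesis using k_dvd[of 2] sd by (simp add: order_Q8 card_roots_of_one_Q8)
  qed
  from assms(9) have "k dvd 1"
  proof (elim disjE)
    assume "V \<cong> Q8"
    then show ?thesis
      using card_roots_of_one_iso[OF V.is_group group_Q8] card_roots_of_one_Q8 order_Q8
        iso_same_card[of V Q8] k_dvd[of 2] by (simp add: order_def)
  next
    assume "is_faithful_semidirect V ?E Q8"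
    then obtain \<phi> where \<phi>: "\<phi> \<in> hom Q8 (AutoGroup ?E)" "V \<cong> semidirect_product ?E Q8 \<phi>"
      by (auto simp: is_faithful_semidirect_def)
    note sd = semidirect[OF groups(2) group_Q8 \<phi>]
    have dvd: "2 dvd order V" "3 dvd order V" using sd(1) by (simp_all add: orders order_Q8)
    have "coprime 3 (order Q8)" by (simp add: order_Q8 coprime_iff_gcd_eq_1 gcd_non_0_nat)
    \<comment> \<open>The count for \<open>p = 3\<close> is that of the normal factor of order 9,
      and \<open>9 - 1 = 2 ^ 3\<close>; the even order of \<open>Q8\<close> makes \<open>k\<close>
      coprime to 2.\<close>
    then have "k dvd 2 ^ 3"
      using k_dvd[of 3] sd(2) dvd card_roots_of_one_integer_mod_group_square[of 3] by simp
    moreover have "coprime k (2 ^ 3)" unfolding coprime_power_right_iff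
      using coprime_k[of 2] dvd by (simp add: coprime_commute)
    ultimately show ?thesis using coprime_common_divisor[of k "2 ^ 3" k] by simp
  qed (use Klein quaternion in auto)
  with \<open>k \<ge> 2\<close> show False by simp
qed

end
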